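(* Let $A\in\mathbb{C}^{n\times n}$ be non-nilpotent with $\mathrm{ind}(A)=k$. Then: (1) $A^{\text{cEP}}=\lim\limits_{\lambda\to 0}A^{k}(A^{k})^{*}\bigl(A^{k+1}(A^{k})^{*}+\lambda I\bigr)^{-1}$; (2) $A_{\text{cEP}}=\lim\limits_{\lambda\to 0}\bigl((A^{k})^{*}A^{k+1}+\lambda I\bigr)^{-1}(A^{k})^{*}A^{k}$, where $A^{\text{cEP}}$ is the core-EP inverse of $A$ and $A_{\text{cEP}}$ is the dual core-EP inverse of $A$.
   Context: $M^*$ is the conjugate transpose, $\mathrm{rk}(M)$ the rank, $R(M)$ the range (column space) of a complex matrix $M$, and $I$ is the identity matrix. The index $\mathrm{ind}(A)$ of a square matrix $A$ is the smallest nonnegative integer $k$ with $\mathrm{rk}(A^k)=\mathrm{rk}(A^{k+1})$. The Drazin inverse $A^D$ of $A\in\mathbb{C}^{n\times n}$ with $k=\mathrm{ind}(A)$ is the unique matrix with $A^{k+1}A^D=A^k$, $A^DAA^D=A^D$, $AA^D=A^DA$. The core-EP inverse $A^{\text{cEP}}$ is the unique matrix $X\in\mathbb{C}^{n\times n}$ with $XAX=X$ and $R(X)=R(X^* )=R(A^D)$. The dual core-EP inverse $A_{\text{cEP}}$ is the unique matrix $X\in\mathbb{C}^{n\times n}$ with $XAX=X$ and $R(X)=R(X^* )=R((A^* )^D)$. Limits are taken as $\lambda\to0$ through nonzero complex scalars; for all sufficiently small $\lambda\ne 0$ the indicated inverses exist. *)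

theory Defs
  imports "HOL-Analysis.Analysis"
begin

definition ctranspose :: "complex^'n^'m \<Rightarrow> complex^'m^'n" where
  "ctranspose M = map_matrix cnj (transpose M)"

(* The library's multiplication and power on vectors and matrices act entrywise,
   so powers with respect to the matrix product need their own definition. *)
primrec matpow :: "'a::semiring_1^'n^'n \<Rightarrow> nat \<Rightarrow> 'a^'n^'n" where
  "matpow A 0 = mat 1"
| "matpow A (Suc m) = A ** matpow A m"

definition mat_range :: "complex^'n^'m \<Rightarrow> (complex^'m) set" where
  "mat_range M = range (\<lambda>x. M *v x)"

definition mat_nilpotent :: "complex^'n^'n \<Rightarrow> bool" where
  "mat_nilpotent A \<longleftrightarrow> (\<exists>m. matpow A m = 0)"

(* rank is the dimension over the complex field, not over the reals. *)
definition mat_index :: "complex^'n^'n \<Rightarrow> nat" where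
  "mat_index A = (LEAST k. rank (matpow A k) = rank (matpow A (k + 1)))"

definition is_drazin_inverse :: "complex^'n^'n \<Rightarrow> complex^'n^'n \<Rightarrow> bool" where
  "is_drazin_inverse A X \<longleftrightarrow>
     matpow A (mat_index A + 1) ** X = matpow A (mat_index A) \<and>
     X ** A ** X = X \<and>
     A ** X = X ** A"

definition drazin_inverse :: "complex^'n^'n \<Rightarrow> complex^'n^'n" where
  "drazin_inverse A = (THE X. is_drazin_inverse A X)"

definition is_core_EP_inverse :: "complex^'n^'n \<Rightarrow> complex^'n^'n \<Rightarrow> bool" where
  "is_core_EP_inverse A X \<longleftrightarrow>
     X ** A ** X = X \<and>
     mat_range X = mat_range (ctranspose X) \<and>
     mat_range (ctranspose X) = mat_range (drazin_inverse A)"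

definition core_EP_inverse :: "complex^'n^'n \<Rightarrow> complex^'n^'n" where
  "core_EP_inverse A = (THE X. is_core_EP_inverse A X)"

definition is_dual_core_EP_inverse :: "complex^'n^'n \<Rightarrow> complex^'n^'n \<Rightarrow> bool" where
  "is_dual_core_EP_inverse A X \<longleftrightarrow>
     X ** A ** X = X \<and>
     mat_range X = mat_range (ctranspose X) \<and>
     mat_range (ctranspose X) = mat_range (drazin_inverse (ctranspose A))"

definition dual_core_EP_inverse :: "complex^'n^'n \<Rightarrow> complex^'n^'n" where
  "dual_core_EP_inverse A = (THE X. is_dual_core_EP_inverse A X)"

end

(* Put a = A^k with k = ind(A). Equality of ranks gives factorizations a = Z A a = A a Y, and
   ker(a^* a) = ker(a) gives a = K a^* a; hence T = A a a^* satisfies T = Z' T^2 = T^2 Y', so T has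
   a group inverse G. One checks that X = a a^* G is the core-EP inverse. On the other hand
   T + l I splits along the complementary idempotents T G and E = I - T G: its inverse is
   E / l + G (I + l G)^-1, and since a a^* E = 0 the singular part disappears after multiplication
   by a a^*, leaving the limit a a^* G. The dual statement is the first one for A^*, conjugate
   transposed. *)
theory Submission
  imports Defs
begin

section \<open>Conjugate transposes\<close>

lemma ctranspose_nth: "ctranspose M $ i $ j = cnj (M $ j $ i)"
  by (simp add: ctranspose_def transpose_def)

lemma ctranspose_ctranspose [simp]: "ctranspose (ctranspose M) = M"
  by (simp add: vec_eq_iff ctranspose_nth)

lemma ctranspose_mult: "ctranspose (A ** B) = ctranspose B ** ctranspose A"
  by (simp add: vec_eq_iff ctranspose_nth matrix_matrix_mult_def mult.commute)

lemma ctranspose_add: "ctranspose (A + B) = ctranspose A + ctranspose B"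
  by (simp add: vec_eq_iff ctranspose_nth)

lemma ctranspose_mat [simp]: "ctranspose (mat c) = mat (cnj c)"
  by (simp add: vec_eq_iff ctranspose_nth mat_def)

lemma ctranspose_eq_iff: "ctranspose A = ctranspose B \<longleftrightarrow> A = B"
  by (metis ctranspose_ctranspose)

text \<open>With \<open>y = M x\<close>, the sum of the squared moduli of the entries of
  \<open>y\<close> equals \<open>y^* y = x^* M^* y\<close>, which vanishes.\<close>

lemma ctranspose_mult_self_eq_0:
  assumes "ctranspose M *v (M *v x) = 0"
  shows "M *v x = 0"
proof -
  define y where "y = M *v x"
  have "(\<Sum>i\<in>UNIV. cnj (y $ i) * y $ i) = (\<Sum>i\<in>UNIV. \<Sum>j\<in>UNIV. cnj (M $ i $ j) * cnj (x $ j) * y $ i)"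
    by (simp add: y_def matrix_vector_mult_def sum_distrib_right)
  also have "\<dots> = (\<Sum>j\<in>UNIV. \<Sum>i\<in>UNIV. cnj (M $ i $ j) * cnj (x $ j) * y $ i)"
    by (rule sum.swap)
  also have "\<dots> = (\<Sum>j\<in>UNIV. cnj (x $ j) * (ctranspose M *v y) $ j)"
    by (simp add: matrix_vector_mult_def ctranspose_nth sum_distrib_left mult_ac)
  also have "\<dots> = 0"
    using assms by (simp add: y_def)
  finally have "complex_of_real (\<Sum>i\<in>UNIV. (cmod (y $ i))\<^sup>2) = 0"
    by (simp only: of_real_sum complex_norm_square mult.commute)
  then have "(\<Sum>i\<in>UNIV. (cmod (y $ i))\<^sup>2) = 0"
    by (simp only: of_real_eq_0_iff)
  then have "y = 0"
    by (simp add: sum_nonneg_eq_0_iff vec_eq_iff)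
  then show ?thesis by (simp add: y_def)
qed

section \<open>Inner inverses, factorizations and rank\<close>

lemma matrix_vector_mult_axis: "(M *v axis j 1) $ i = (M $ i $ j :: 'a::semiring_1)"
  by (simp add: matrix_vector_mult_def axis_def if_distrib cong: if_cong)

text \<open>A linear map has a linear right inverse on its image; the matrix of that right inverse
  serves. This turns inclusions of ranges or kernels into matrix factorizations.\<close>

lemma matrix_inner_inverse_exists:
  fixes N :: "'a::field^'n^'m"
  obtains N' where "N ** N' ** N = N"
proof -
  have "Vector_Spaces.linear (*s) (*s) ((*v) N)" by simp
  from vec.linear_exists_right_inverse_on[OF this vec.subspace_UNIV]
  obtain g where g: "Vector_Spaces.linear (*s) (*s) g" "\<And>x. N *v g (N *v x) = N *v x"
    by auto
  have "N ** matrix g ** N = N"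
  proof (subst matrix_eq, intro allI)
    fix x
    show "(N ** matrix g ** N) *v x = N *v x"
      using g by (simp add: matrix_vector_mul_assoc[symmetric] matrix_works)
  qed
  then show thesis by (rule that)
qed

text \<open>\<open>N N'\<close> is the identity on the range of \<open>N\<close>, hence
  \<open>N N' M = M\<close>.\<close>

lemma range_subset_imp_right_factor:
  fixes M :: "'a::field^'p^'m" and N :: "'a^'n^'m"
  assumes "range ((*v) M) \<subseteq> range ((*v) N)"
  obtains K where "M = N ** K"
proof -
  obtain N' where N': "N ** N' ** N = N" by (rule matrix_inner_inverse_exists)
  have "M = N ** (N' ** M)"
  proof (subst matrix_eq, intro allI)
    fix x
    obtain y where "M *v x = N *v y" using assms by blast
    then show "M *v x = (N ** (N' ** M)) *v x"
      using N' by (metis matrix_vector_mul_assoc)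
  qed
  then show thesis by (rule that)
qed

text \<open>\<open>x - N' N x\<close> lies in the kernel of \<open>N\<close>, hence in that of
  \<open>M\<close>, so \<open>M = M N' N\<close>.\<close>

lemma kernel_subset_imp_left_factor:
  fixes M :: "'a::field^'n^'p" and N :: "'a^'n^'m"
  assumes "\<And>x. N *v x = 0 \<Longrightarrow> M *v x = 0"
  obtains K where "M = K ** N"
proof -
  obtain N' where N': "N ** N' ** N = N" by (rule matrix_inner_inverse_exists)
  have "M = M ** N' ** N"
  proof (subst matrix_eq, intro allI)
    fix x
    have "N *v (x - N' *v (N *v x)) = 0"
      using N' by (simp add: matrix_vector_mult_diff_distrib matrix_vector_mul_assoc matrix_mul_assoc)
    from assms[OF this] show "M *v x = (M ** N' ** N) *v x"
      by (simp add: matrix_vector_mult_diff_distrib matrix_vector_mul_assoc matrix_mul_assoc)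
  qed
  then show thesis by (rule that)
qed

text \<open>\<open>rank\<close> is the dimension of the row space. Writing that space as a range
  makes the factorization lemmas applicable.\<close>

lemma rank_eq_dim_range_transpose:
  fixes A :: "'a::field^'n^'m"
  shows "rank A = vec.dim (range ((*v) (transpose A)))"
proof -
  have "range ((*v) (transpose A)) = vec.span (rows A)"
  proof
    show "range ((*v) (transpose A)) \<subseteq> vec.span (rows A)"
      using matrix_vector_mult_in_columnspace_gen[of "transpose A"]
      by (auto simp del: transpose_matrix_vector)
    have "row i A = transpose A *v axis i 1" for i
      by (simp add: vec_eq_iff row_def matrix_vector_mult_axis transpose_def
          del: transpose_matrix_vector)
    then have "rows A \<subseteq> range ((*v) (transpose A))"
      unfolding rows_def by blast
    moreover have "vec.subspace (range ((*v) (transpose A)))"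
      by (rule vec.subspace_image[OF vec.subspace_UNIV])
    ultimately show "vec.span (rows A) \<subseteq> range ((*v) (transpose A))"
      by (rule vec.span_minimal)
  qed
  then show ?thesis by (simp add: row_rank_def_gen vec.dim_span)
qed

lemma range_mult_subset: "range ((*v) (M ** N)) \<subseteq> range ((*v) M)"
  by (auto simp: matrix_vector_mul_assoc[symmetric])

lemma rank_mult_le_right:
  fixes A :: "'a::field^'n^'m" and B :: "'a^'m^'p"
  shows "rank (B ** A) \<le> rank A"
  unfolding rank_eq_dim_range_transpose matrix_transpose_mul
  by (intro vec.dim_subset range_mult_subset)

text \<open>The row space of \<open>B A\<close> lies in that of \<open>A\<close>, so equal
  dimensions force equality, and a right factorization of the transposes gives \<open>Z\<close>.
  Conversely, multiplying on the left never raises the rank.\<close>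

lemma rank_mult_eq_iff_left_factor:
  fixes A :: "'a::field^'n^'m" and B :: "'a^'m^'p"
  shows "rank (B ** A) = rank A \<longleftrightarrow> (\<exists>Z. A = Z ** (B ** A))"
proof
  assume eq: "rank (B ** A) = rank A"
  have "range ((*v) (transpose (B ** A))) = range ((*v) (transpose A))"
  proof (rule vec.subspace_dim_equal)
    show "range ((*v) (transpose (B ** A))) \<subseteq> range ((*v) (transpose A))"
      unfolding matrix_transpose_mul by (rule range_mult_subset)
    show "vec.dim (range ((*v) (transpose A))) \<le> vec.dim (range ((*v) (transpose (B ** A))))"
      using eq by (simp add: rank_eq_dim_range_transpose)
  qed (rule vec.subspace_image[OF vec.subspace_UNIV])+
  then obtain K where "transpose A = transpose (B ** A) ** K"
    by (metis range_subset_imp_right_factor subset_refl)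
  then have "A = transpose K ** (B ** A)"
    by (metis matrix_transpose_mul transpose_transpose)
  then show "\<exists>Z. A = Z ** (B ** A)" ..
next
  assume "\<exists>Z. A = Z ** (B ** A)"
  then show "rank (B ** A) = rank A"
    by (metis rank_mult_le_right order_antisym)
qed

text \<open>An injective endomorphism of the finite-dimensional space \<open>R(C)\<close> is surjective.\<close>

lemma left_factor_imp_right_factor:
  fixes A B C :: "'a::field^'n^'n"
  assumes AC: "A ** C = C ** B" and Z: "C = Z ** (A ** C)"
  obtains Y where "C = A ** C ** Y"
proof -
  have "inj_on ((*v) A) (range ((*v) C))"
  proof (rule inj_onI, clarsimp)
    fix x y assume "A *v (C *v x) = A *v (C *v y)"
    then show "C *v x = C *v y"
      using Z by (metis matrix_vector_mul_assoc)
  qed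
  moreover have subsp: "vec.subspace (range ((*v) M))" for M :: "'a^'n^'n"
    by (rule vec.subspace_image[OF vec.subspace_UNIV])
  ultimately have "vec.dim ((*v) A ` range ((*v) C)) = vec.dim (range ((*v) C))"
    by (intro vec.dim_image_eq) (auto simp: vec.span_eq_iff[THEN iffD2])
  moreover have img: "(*v) A ` range ((*v) C) = range ((*v) (A ** C))"
    by (auto simp: matrix_vector_mul_assoc[symmetric])
  moreover have "range ((*v) (A ** C)) \<subseteq> range ((*v) C)"
    unfolding AC by (rule range_mult_subset)
  ultimately have "range ((*v) (A ** C)) = range ((*v) C)"
    by (intro vec.subspace_dim_equal subsp) auto
  then show thesis
    by (metis range_subset_imp_right_factor subset_refl that)
qed

section \<open>Powers, scalar matrices and distributivity\<close>

lemma matpow_commute: "A ** matpow A m = matpow A m ** A"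
  by (induction m) (simp_all, metis matrix_mul_assoc)

lemma ctranspose_matpow: "ctranspose (matpow A m) = matpow (ctranspose A) m"
  by (induction m) (simp_all add: ctranspose_mult matpow_commute)

lemma mat_mult_commute:
  fixes M :: "'a::comm_semiring_1^'n^'n"
  shows "mat c ** M = M ** mat c"
  by (simp add: vec_eq_iff matrix_matrix_mult_def mat_def mult_delta_left
      mult_delta_right mult.commute)

lemma mat_mult_mat: "mat c ** mat d = (mat (c * d) :: 'a::semiring_1^'n^'n)"
  by (simp add: vec_eq_iff matrix_matrix_mult_def mat_def mult_delta_left
      mult_delta_right)

lemma matrix_mult_add_rdistrib:
  fixes A B :: "'a::semiring_1^'n^'m" and C :: "'a^'p^'n"
  shows "(A + B) ** C = A ** C + B ** C"
  by (simp add: vec_eq_iff matrix_matrix_mult_def distrib_right sum.distrib)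

lemma matrix_mult_diff_ldistrib:
  fixes A :: "'a::ring_1^'n^'m" and B C :: "'a^'p^'n"
  shows "A ** (B - C) = A ** B - A ** C"
  by (simp add: vec_eq_iff matrix_matrix_mult_def right_diff_distrib sum_subtractf)

lemma matrix_mult_diff_rdistrib:
  fixes A B :: "'a::ring_1^'n^'m" and C :: "'a^'p^'n"
  shows "(A - B) ** C = A ** C - B ** C"
  by (simp add: vec_eq_iff matrix_matrix_mult_def left_diff_distrib sum_subtractf)

section \<open>Limits of determinants, products and inverses\<close>

lemma tendsto_det:
  fixes F :: "'b \<Rightarrow> 'a::real_normed_field^'n^'n"
  assumes "(F \<longlongrightarrow> L) net"
  shows "((\<lambda>x. det (F x)) \<longlongrightarrow> det L) net"
  unfolding det_def by (intro tendsto_intros assms)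

lemma tendsto_matrix_mult:
  fixes F :: "'b \<Rightarrow> 'a::real_normed_field^'n^'m" and G :: "'b \<Rightarrow> 'a^'p^'n"
  assumes "(F \<longlongrightarrow> L) net" "(G \<longlongrightarrow> M) net"
  shows "((\<lambda>x. F x ** G x) \<longlongrightarrow> L ** M) net"
  unfolding matrix_matrix_mult_def by (intro tendsto_intros assms)

text \<open>\<open>matrix_inv\<close> chooses a two-sided inverse; for square matrices over a field
  a right inverse is already two-sided, so one equation determines it.\<close>

lemma matrix_inv_unique:
  fixes A B :: "'a::field^'n^'n"
  assumes "A ** B = mat 1"
  shows "matrix_inv A = B"
proof -
  have "A ** matrix_inv A = mat 1 \<and> matrix_inv A ** A = mat 1"
    unfolding matrix_inv_def
    by (rule someI[of _ B]) (use assms matrix_left_right_inverse in blast)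
  then show ?thesis
    by (metis assms matrix_mul_assoc matrix_mul_lid matrix_mul_rid)
qed

lemma matrix_inv_mult:
  fixes A :: "'a::field^'n^'n"
  assumes "invertible A"
  shows "A ** matrix_inv A = mat 1" "matrix_inv A ** A = mat 1"
  using assms matrix_inv_unique unfolding invertible_def by blast+

lemma eventually_invertible:
  fixes F :: "'b \<Rightarrow> 'a::real_normed_field^'n^'n"
  assumes "(F \<longlongrightarrow> L) net" "invertible L"
  shows "\<forall>\<^sub>F x in net. invertible (F x)"
  unfolding invertible_det_nz
  using tendsto_imp_eventually_ne[OF tendsto_det[OF assms(1)]] assms(2)
  by (simp add: invertible_det_nz)

text \<open>By Cramer's rule the entries of the inverse are quotients of determinants, continuous
  wherever the denominator is nonzero.\<close>

lemma tendsto_matrix_inv: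
  fixes F :: "'b \<Rightarrow> 'a::real_normed_field^'n^'n"
  assumes F: "(F \<longlongrightarrow> L) net" and L: "invertible L"
  shows "((\<lambda>x. matrix_inv (F x)) \<longlongrightarrow> matrix_inv L) net"
proof -
  \<comment> \<open>Entry \<open>(k, j)\<close>: column \<open>k\<close> of \<open>M\<close> is
    replaced by the unit vector \<open>e_j\<close>, since column \<open>j\<close> of the inverse
    solves \<open>M x = e_j\<close>.\<close>
  let ?C = "\<lambda>M::'a^'n^'n. \<chi> k j. det (\<chi> i l. if l = k then axis j 1 $ i else M $ i $ l) / det M"
  have C: "matrix_inv M = ?C M" if "invertible M" for M :: "'a^'n^'n"
  proof -
    have "M *v (matrix_inv M *v axis j 1) = axis j 1" for j
      using matrix_inv_mult[OF that] by (simp add: matrix_vector_mul_assoc)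
    then have "matrix_inv M *v axis j 1 = (\<chi> k. ?C M $ k $ j)" for j
      using cramer[of M "matrix_inv M *v axis j 1" "axis j 1"] that
      by (simp add: invertible_det_nz)
    then show ?thesis
      by (simp add: matrix_vector_mult_axis vec_eq_iff)
  qed
  have "((\<lambda>x. ?C (F x)) \<longlongrightarrow> ?C L) net"
  proof (intro tendsto_vec_lambda tendsto_divide tendsto_det F)
    show "((\<lambda>x. if l = k then axis j 1 $ i else F x $ i $ l) \<longlongrightarrow>
        (if l = k then axis j 1 $ i else L $ i $ l)) net" for i j k l
      using F by (auto intro!: tendsto_intros)
    show "det L \<noteq> 0" using L by (simp add: invertible_det_nz)
  qed
  moreover have "\<forall>\<^sub>F x in net. ?C (F x) = matrix_inv (F x)"
    using eventually_invertible[OF F L] by eventually_elim (simp only: C)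
  ultimately have "((\<lambda>x. matrix_inv (F x)) \<longlongrightarrow> ?C L) net"
    by (rule Lim_transform_eventually)
  then show ?thesis by (simp only: C[OF L])
qed


section \<open>The regularized inverse in the presence of a group inverse\<close>

text \<open>The first three hypotheses make \<open>G\<close> the group inverse of \<open>T\<close>;
  the last one says \<open>M E = 0\<close>, so \<open>M\<close> cancels the pole of the inverse at
  0.\<close>

lemma group_inverse_shifted_inverse_limit:
  fixes M T G :: "complex^'n^'n"
  assumes TGT: "T ** G ** T = T" and GTG: "G ** T ** G = G" and comm: "T ** G = G ** T"
    and MTG: "M ** T ** G = M"
  shows "\<forall>\<^sub>F l in at 0. invertible (T + mat l)"
    and "((\<lambda>l. M ** matrix_inv (T + mat l)) \<longlongrightarrow> M ** G) (at 0)"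
proof -
  define E where "E = mat 1 - T ** G"
  define V where "V l = matrix_inv (mat 1 + mat l ** G)" for l
  have lim_mat: "((\<lambda>l. mat l) \<longlongrightarrow> (mat 0 :: complex^'n^'n)) (at 0)"
  proof (intro vec_tendstoI)
    show "((\<lambda>l. mat l $ i $ j) \<longlongrightarrow> (mat 0 :: complex^'n^'n) $ i $ j) (at 0)" for i j
      by (cases "i = j") (simp_all add: mat_def)
  qed
  have "((\<lambda>l. mat 1 + mat l ** G) \<longlongrightarrow> mat 1 + mat 0 ** G) (at 0)"
    by (intro tendsto_add tendsto_const tendsto_matrix_mult lim_mat)
  then have lim1: "((\<lambda>l. mat 1 + mat l ** G) \<longlongrightarrow> mat 1) (at 0)"
    by simp
  have inv1: "invertible (mat 1 :: complex^'n^'n)"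
    by (metis invertible_def matrix_mul_lid)
  have "((\<lambda>l. M ** G ** V l) \<longlongrightarrow> M ** G ** matrix_inv (mat 1)) (at 0)"
    unfolding V_def by (intro tendsto_matrix_mult tendsto_const tendsto_matrix_inv lim1 inv1)
  then have lim: "((\<lambda>l. M ** G ** V l) \<longlongrightarrow> M ** G) (at 0)"
    using matrix_inv_unique[of "mat 1" "mat 1 :: complex^'n^'n"] by simp
  have TE: "T ** E = 0" and EG: "E ** G = 0"
    using TGT GTG comm by (simp_all add: E_def matrix_mult_diff_ldistrib matrix_mult_diff_rdistrib matrix_mul_assoc)
  have ME: "M ** E = 0"
    using MTG by (simp add: E_def matrix_mult_diff_ldistrib matrix_mul_assoc)
  have key: "invertible (T + mat l) \<and> M ** matrix_inv (T + mat l) = M ** G ** V l"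
    if inv: "invertible (mat 1 + mat l ** G)" and l: "l \<noteq> 0" for l
  proof -
    let ?U = "mat 1 + mat l ** G"
    have UV: "?U ** V l = mat 1"
      unfolding V_def by (rule matrix_inv_mult(1)[OF inv])
    \<comment> \<open>Because \<open>E G = 0\<close>, the factor \<open>I + l G\<close> and its
      inverse \<open>V l\<close> are both invisible to the right of \<open>E\<close>.\<close>
    have "E ** ?U = E"
      using EG by (simp add: matrix_add_ldistrib matrix_mul_assoc mat_mult_commute[symmetric])
         (simp add: matrix_mul_assoc[symmetric])
    then have EV: "E ** V l = E"
      using UV by (metis matrix_mul_assoc matrix_mul_rid)
    \<comment> \<open>On the range of \<open>E\<close> the matrix \<open>T\<close> vanishes, so
      \<open>T + l I\<close> is multiplication by \<open>l\<close> there.\<close>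
    have "(T + mat l) ** (mat (1 / l) ** E) = mat l ** (mat (1 / l) ** E)"
      using TE by (simp add: matrix_mult_add_rdistrib mat_mult_commute[of _ E] matrix_mul_assoc)
    also have "\<dots> = E"
      using l by (simp add: matrix_mul_assoc mat_mult_mat)
    finally have 1: "(T + mat l) ** (mat (1 / l) ** E) = E" .
    \<comment> \<open>\<open>T G = I - E\<close>, hence \<open>T G + l G = I + l G - E\<close>;
      multiplying by \<open>V l\<close> leaves the complementary idempotent
      \<open>I - E\<close>.\<close>
    have "(T + mat l) ** G = ?U - E"
      by (simp add: E_def matrix_mult_add_rdistrib)
    then have 2: "(T + mat l) ** (G ** V l) = mat 1 - E"
      using UV EV by (simp add: matrix_mul_assoc matrix_mult_diff_rdistrib)
    have I: "(T + mat l) ** (mat (1 / l) ** E + G ** V l) = mat 1"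
      using 1 2 by (simp add: matrix_add_ldistrib)
    have "M ** (mat (1 / l) ** E) = 0"
      using ME by (simp add: mat_mult_commute matrix_mul_assoc)
    then have "M ** matrix_inv (T + mat l) = M ** G ** V l"
      using matrix_inv_unique[OF I] by (simp add: matrix_add_ldistrib matrix_mul_assoc)
    then show ?thesis
      using I invertible_right_inverse by blast
  qed
  have ev: "\<forall>\<^sub>F l in at 0. invertible (T + mat l) \<and> M ** matrix_inv (T + mat l) = M ** G ** V l"
    using eventually_invertible[OF lim1 inv1] eventually_neq_at_within[of 0 0 UNIV]
    by eventually_elim (rule key)
  then show "\<forall>\<^sub>F l in at 0. invertible (T + mat l)"
    by eventually_elim simp
  from ev have "\<forall>\<^sub>F l in at 0. M ** G ** V l = M ** matrix_inv (T + mat l)"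
    by eventually_elim simp
  with lim show "((\<lambda>l. M ** matrix_inv (T + mat l)) \<longlongrightarrow> M ** G) (at 0)"
    by (rule Lim_transform_eventually)
qed

section \<open>Existence of the Drazin inverse and its powers\<close>

text \<open>The witness is \<open>A^k Y^(k+1) = Z^(k+1) A^k\<close>. It is used with
  \<open>k\<close> the index of \<open>A\<close>, and with exponent 1, where it yields a group
  inverse.\<close>

lemma drazin_exists:
  fixes A :: "'a::field^'n^'n"
  assumes Z: "matpow A k = Z ** (A ** matpow A k)"
    and Y: "matpow A k = A ** matpow A k ** Y"
  obtains D where "A ** matpow A k ** D = matpow A k" "D ** A ** D = D" "A ** D = D ** A"
proof -
  let ?a = "matpow A k"
  have Z': "Z ** (A ** ?a) = ?a" by (rule Z[symmetric])
  have Y': "A ** ?a ** Y = ?a" by (rule Y[symmetric])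
  \<comment> \<open>\<open>P m\<close> plays the role of \<open>A^(-m) A^k\<close>: multiplying by
    \<open>A\<close> on either side lowers \<open>m\<close> by one. The form with \<open>Y\<close>
    serves products from the left, the form with \<open>Z\<close> those from the right.\<close>
  define P where "P m = ?a ** matpow Y m" for m
  have Zm: "P m = matpow Z m ** ?a" for m
  proof (induction m)
    case (Suc m)
    have "Z ** ?a = Z ** (A ** ?a ** Y)" by (simp only: Y')
    also have "\<dots> = ?a ** Y" using Z' by (metis matrix_mul_assoc)
    finally have "Z ** ?a = ?a ** Y" .
    have "matpow Z (Suc m) ** ?a = Z ** P m"
      by (simp add: Suc.IH matrix_mul_assoc)
    also have "\<dots> = ?a ** Y ** matpow Y m"
      unfolding P_def using \<open>Z ** ?a = ?a ** Y\<close> by (simp add: matrix_mul_assoc)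
    finally show ?case by (simp add: P_def matrix_mul_assoc)
  qed (simp add: P_def)
  have AP: "A ** P (Suc m) = P m" for m
    using Y' by (simp add: P_def matrix_mul_assoc)
  have PA: "P (Suc m) ** A = P m" for m
  proof -
    have "P (Suc m) ** A = matpow Z m ** Z ** (?a ** A)"
      by (simp add: Zm matpow_commute matrix_mul_assoc)
    also have "\<dots> = matpow Z m ** (Z ** (A ** ?a))"
      by (simp add: matpow_commute matrix_mul_assoc)
    finally show ?thesis by (simp only: Z' Zm[of m])
  qed
  have AmP: "matpow A m ** P m = ?a" for m
  proof (induction m)
    case (Suc m)
    have "matpow A (Suc m) ** P (Suc m) = matpow A m ** (A ** P (Suc m))"
      by (simp add: matpow_commute matrix_mul_assoc)
    then show ?case using Suc AP by simp
  qed (simp add: P_def)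
  \<comment> \<open>The exponent \<open>k + 1\<close> cancels exactly the \<open>k + 1\<close>
    factors in \<open>A^(k+1) D = A^k\<close>.\<close>
  let ?D = "P (Suc k)"
  have "A ** ?a ** ?D = ?a"
    using AmP[of "Suc k"] by simp
  moreover have "?D ** A ** ?D = ?D"
  proof -
    have "?D ** A ** ?D = P k ** ?D" by (simp only: PA)
    also have "\<dots> = matpow Z k ** ?a ** ?D" by (simp only: Zm[of k])
    \<comment> \<open>One factor \<open>Y\<close> is split off so that \<open>A^k P k\<close>
      appears, which collapses to \<open>A^k\<close>.\<close>
    also have "\<dots> = matpow Z k ** (?a ** P k) ** Y"
      by (simp add: P_def matpow_commute matrix_mul_assoc)
    also have "\<dots> = matpow Z k ** ?a ** Y" by (simp only: AmP)
    also have "\<dots> = P k ** Y" by (simp only: Zm)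
    also have "\<dots> = ?D" by (simp add: P_def matpow_commute matrix_mul_assoc)
    finally show ?thesis .
  qed
  moreover have "A ** ?D = ?D ** A" by (simp add: AP PA)
  ultimately show thesis by (rule that)
qed

lemma matpow_commute_of_commute:
  assumes "A ** B = B ** A"
  shows "matpow A m ** B = B ** matpow A m"
  by (induction m) (simp_all, metis assms matrix_mul_assoc)

text \<open>The middle factor \<open>D A D = D\<close> can be peeled off once per power, because
  \<open>D\<close> commutes with the powers of \<open>A\<close>.\<close>

lemma drazin_power_commute:
  assumes "D ** A ** D = D" "A ** D = D ** A"
  shows "matpow A m ** matpow D m ** D = D" "matpow D m ** matpow A m ** D = D"
    "matpow A m ** D = D ** matpow A m"
proof -
  show c: "matpow A m ** D = D ** matpow A m" for m
    by (rule matpow_commute_of_commute[OF assms(2)])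
  show "matpow D m ** matpow A m ** D = D" for m
  proof (induction m)
    case (Suc m)
    have "matpow D (Suc m) ** matpow A (Suc m) ** D
        = matpow D m ** (D ** A) ** (matpow A m ** D)"
      by (simp add: matpow_commute[of D] matrix_mul_assoc)
    also have "\<dots> = matpow D m ** (D ** A ** D) ** matpow A m"
      by (simp add: c matrix_mul_assoc)
    also have "\<dots> = matpow D m ** D ** matpow A m"
      by (simp only: assms(1))
    also have "\<dots> = matpow D m ** matpow A m ** D"
      by (simp add: c matrix_mul_assoc[symmetric])
    finally show ?case using Suc by simp
  qed simp
  then show "matpow A m ** matpow D m ** D = D" for m
    using matpow_commute_of_commute[OF c[of m, symmetric], of m] by metis
qed

section \<open>Factorizations at the index\<close>

text \<open>The ranks of the powers decrease in the naturals, so they must stall; hence the least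
  such exponent attains equality, and equal ranks give the factor.\<close>

lemma index_left_factor:
  obtains Z where "matpow A (mat_index A) = Z ** (A ** matpow A (mat_index A))"
proof -
  let ?r = "\<lambda>m. rank (matpow A m)"
  have dec: "?r (Suc m) \<le> ?r m" for m
    using rank_mult_le_right by simp
  have "\<exists>m. ?r m = ?r (m + 1)"
  proof (rule ccontr)
    assume "\<not> ?thesis"
    then have lt: "?r (Suc m) < ?r m" for m
      using dec[of m] by (metis Suc_eq_plus1 le_neq_implies_less)
    \<comment> \<open>Strict descent costs at least one per step, which is impossible after
      \<open>rank (A^0) + 1\<close> steps.\<close>
    have "?r m + m \<le> ?r 0" for m
    proof (induction m)
      case (Suc m)
      then show ?case using lt[of m] by linarith
    qed simp
    from this[of "Suc (?r 0)"] show False by simp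
  qed
  then have "?r (mat_index A) = ?r (mat_index A + 1)"
    unfolding mat_index_def by (rule LeastI_ex)
  then show thesis
    using rank_mult_eq_iff_left_factor that by (metis Suc_eq_plus1 matpow.simps(2))
qed

lemma index_right_factor:
  obtains Y where "matpow A (mat_index A) = A ** matpow A (mat_index A) ** Y"
proof -
  obtain Z where "matpow A (mat_index A) = Z ** (A ** matpow A (mat_index A))"
    by (rule index_left_factor)
  then obtain Y where "matpow A (mat_index A) = A ** matpow A (mat_index A) ** Y"
    by (rule left_factor_imp_right_factor[OF matpow_commute])
  then show thesis by (rule that)
qed

text \<open>Stalling ranks give a left factor for \<open>A\<close>, hence a right factor; its
  conjugate transpose is a left factor for \<open>A^*\<close>. The converse follows by
  involution.\<close>

lemma rank_matpow_ctranspose: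
  "rank (matpow (ctranspose A) m) = rank (matpow (ctranspose A) (m + 1))
    \<longleftrightarrow> rank (matpow A m) = rank (matpow A (m + 1))"
proof -
  have *: "rank (matpow (ctranspose A) m) = rank (matpow (ctranspose A) (m + 1))"
    if eq: "rank (matpow A m) = rank (matpow A (m + 1))" for A :: "complex^'n^'n"
  proof -
    obtain Z where "matpow A m = Z ** (A ** matpow A m)"
      using eq rank_mult_eq_iff_left_factor by (metis Suc_eq_plus1 matpow.simps(2))
    then obtain Y where "matpow A m = A ** matpow A m ** Y"
      using left_factor_imp_right_factor[OF matpow_commute] by blast
    then have "ctranspose (matpow A m) = ctranspose Y ** (ctranspose (matpow A m) ** ctranspose A)"
      by (metis ctranspose_mult)
    then have "matpow (ctranspose A) m
        = ctranspose Y ** (ctranspose A ** matpow (ctranspose A) m)"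
      by (simp add: ctranspose_matpow matpow_commute)
    then show ?thesis
      using rank_mult_eq_iff_left_factor by (metis Suc_eq_plus1 matpow.simps(2))
  qed
  show ?thesis using *[of A] *[of "ctranspose A"] by auto
qed

lemma mat_index_ctranspose: "mat_index (ctranspose A) = mat_index A"
  by (simp only: mat_index_def rank_matpow_ctranspose)

section \<open>Uniqueness and range of the Drazin inverse\<close>

lemma mat_range_eqI:
  assumes "M = N ** U" "N = M ** V"
  shows "mat_range M = mat_range N"
  unfolding mat_range_def
proof (rule subset_antisym)
  show "range ((*v) M) \<subseteq> range ((*v) N)"
    by (subst assms(1)) (rule range_mult_subset)
  show "range ((*v) N) \<subseteq> range ((*v) M)"
    by (subst assms(2)) (rule range_mult_subset)
qed

lemma mat_range_eqE:
  assumes "mat_range M = mat_range N"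
  obtains U V where "M = N ** U" "N = M ** V"
proof -
  obtain U where U: "M = N ** U"
    using range_subset_imp_right_factor[of M N] assms unfolding mat_range_def by auto
  obtain V where "N = M ** V"
    using range_subset_imp_right_factor[of N M] assms unfolding mat_range_def by auto
  with U show thesis by (rule that)
qed

text \<open>Both candidates equal \<open>D A D'\<close>.\<close>

lemma is_drazin_inverse_unique:
  assumes "is_drazin_inverse A D" "is_drazin_inverse A D'"
  shows "D = D'"
proof -
  let ?k = "mat_index A"
  have D: "D ** A ** D = D" "A ** D = D ** A"
    and D': "D' ** A ** D' = D'" "A ** D' = D' ** A"
    and k: "matpow A (?k + 1) ** D = matpow A ?k" "matpow A (?k + 1) ** D' = matpow A ?k"
    using assms by (auto simp: is_drazin_inverse_def)
  \<comment> \<open>The factor \<open>A^k\<close> is exposed in order to be replaced by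
    \<open>A^(k+1) D'\<close>.\<close>
  have "D = matpow D ?k ** D ** matpow A ?k"
    using drazin_power_commute(2,3)[OF D] by (metis matrix_mul_assoc)
  also have "\<dots> = matpow D ?k ** D ** (matpow A ?k ** A ** D')"
    using k(2) by (simp add: matpow_commute)
  also have "\<dots> = matpow D ?k ** D ** matpow A ?k ** A ** D'"
    by (simp add: matrix_mul_assoc)
  also have "\<dots> = D ** A ** D'"
    using drazin_power_commute(2,3)[OF D] by (metis matrix_mul_assoc)
  finally have "D = D ** A ** D'" .
  \<comment> \<open>\<open>D A\<close> fixes the range of \<open>A^k\<close>, and \<open>D'\<close>
    has \<open>A^k\<close> as a left factor.\<close>
  moreover have "D ** A ** matpow A ?k = matpow A ?k"
    using k(1) drazin_power_commute(3)[OF D, of "?k + 1"] by (simp add: matrix_mul_assoc)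
  then have "D ** A ** D' = D'"
    using drazin_power_commute(1)[OF D', of ?k] by (metis matrix_mul_assoc)
  ultimately show ?thesis by simp
qed

text \<open>\<open>D = A^k D^k D\<close> and \<open>A^k = D A A^k\<close> give the two inclusions.
  The core-EP conditions can then be stated through \<open>A^k\<close> alone.\<close>

lemma mat_range_drazin: "mat_range (drazin_inverse A) = mat_range (matpow A (mat_index A))"
proof -
  let ?a = "matpow A (mat_index A)"
  obtain Z where Z: "?a = Z ** (A ** ?a)" by (rule index_left_factor)
  obtain Y where Y: "?a = A ** ?a ** Y" by (rule index_right_factor)
  obtain D where D: "A ** ?a ** D = ?a" "D ** A ** D = D" "A ** D = D ** A"
    by (rule drazin_exists[OF Z Y])
  then have "is_drazin_inverse A D"
    by (simp add: is_drazin_inverse_def)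
  then have "drazin_inverse A = D"
    unfolding drazin_inverse_def using is_drazin_inverse_unique by blast
  moreover have "mat_range D = mat_range ?a"
  proof (rule mat_range_eqI)
    show "D = ?a ** (matpow D (mat_index A) ** D)"
      using drazin_power_commute(1)[OF D(2,3)] by (simp add: matrix_mul_assoc)
    have "D ** (A ** ?a) = A ** (D ** ?a)"
      by (simp only: matrix_mul_assoc D(3))
    also have "\<dots> = A ** (?a ** D)"
      by (simp only: drazin_power_commute(3)[OF D(2,3)])
    also have "\<dots> = ?a"
      by (simp only: matrix_mul_assoc D(1))
    finally show "?a = D ** (A ** ?a)" by (rule sym)
  qed
  ultimately show ?thesis by simp
qed

section \<open>The core-EP inverse: uniqueness, existence and limit\<close>

lemma is_core_EP_inverse_iff:
  "is_core_EP_inverse A X \<longleftrightarrow> X ** A ** X = X \<and>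
     mat_range X = mat_range (matpow A (mat_index A)) \<and>
     mat_range (ctranspose X) = mat_range (matpow A (mat_index A))"
  unfolding is_core_EP_inverse_def mat_range_drazin by (rule conj_cong[OF refl], rule iffI) (simp_all)

lemma ctranspose_mult_self_left_factor:
  fixes a :: "complex^'n^'m"
  obtains K where "a = K ** (ctranspose a ** a)"
proof (rule kernel_subset_imp_left_factor)
  show "a *v x = 0" if "(ctranspose a ** a) *v x = 0" for x
    by (rule ctranspose_mult_self_eq_0) (simp only: matrix_vector_mul_assoc that)
qed

text \<open>The range of \<open>X\<close> fixes the product \<open>X a = a Y\<close>, and the range
  of \<open>X^*\<close> gives \<open>X = W a^*\<close>. Since \<open>a^* = a^* a K^*\<close>, it
  follows that \<open>X = X a K^* = a Y K^*\<close>, where \<open>Y\<close> and \<open>K\<close>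
  depend on \<open>A\<close> only.\<close>

lemma is_core_EP_inverse_unique:
  assumes "is_core_EP_inverse A X" "is_core_EP_inverse A X'"
  shows "X = X'"
proof -
  let ?a = "matpow A (mat_index A)"
  obtain Y where Y: "?a = A ** ?a ** Y" by (rule index_right_factor)
  obtain K where K: "?a = K ** (ctranspose ?a ** ?a)" by (rule ctranspose_mult_self_left_factor)
  have K': "ctranspose ?a ** (?a ** ctranspose K) = ctranspose ?a"
    using arg_cong[OF K[symmetric], of ctranspose] by (simp add: ctranspose_mult matrix_mul_assoc)
  have *: "X ** ?a = ?a ** Y \<and> (\<exists>W. X = W ** ctranspose ?a)" if "is_core_EP_inverse A X" for X
  proof
    from that have X: "X ** A ** X = X" "mat_range X = mat_range ?a"
      "mat_range (ctranspose X) = mat_range ?a"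
      by (auto simp: is_core_EP_inverse_iff)
    from X(2) obtain U where "?a = X ** U" by (metis mat_range_eqE)
    \<comment> \<open>\<open>X A\<close> is the identity on the range of \<open>X\<close>, which
      contains that of \<open>a\<close>.\<close>
    then have "X ** A ** ?a = ?a" using X(1) by (metis matrix_mul_assoc)
    then show "X ** ?a = ?a ** Y" using Y by (metis matrix_mul_assoc)
    from X(3) obtain W where "ctranspose X = ?a ** W" by (metis mat_range_eqE)
    then show "\<exists>W. X = W ** ctranspose ?a" by (metis ctranspose_ctranspose ctranspose_mult)
  qed
  have "X = X ** ?a ** ctranspose K" if "is_core_EP_inverse A X" for X
    using *[OF that] K' by (metis matrix_mul_assoc)
  then show ?thesis using * assms by metis
qed

text \<open>The three claims share the group inverse \<open>G\<close> of \<open>T = A a a^*\<close>: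
  it supplies both the limit and the witness that the core-EP inverse exists.\<close>

lemma core_EP_inverse_limit:
  fixes A :: "complex^'n^'n"
  defines "a \<equiv> matpow A (mat_index A)"
  shows "\<forall>\<^sub>F l in at 0. invertible (A ** a ** ctranspose a + mat l)"
    and "((\<lambda>l. a ** ctranspose a ** matrix_inv (A ** a ** ctranspose a + mat l))
      \<longlongrightarrow> core_EP_inverse A) (at 0)"
    and "is_core_EP_inverse A (core_EP_inverse A)"
proof -
  obtain Z where "a = Z ** (A ** a)"
    unfolding a_def by (rule index_left_factor)
  then have Z: "Z ** (A ** a) = a" by (rule sym)
  obtain Y where "a = A ** a ** Y"
    unfolding a_def by (rule index_right_factor)
  then have Y: "A ** a ** Y = a" by (rule sym)
  obtain K where "a = K ** (ctranspose a ** a)"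
    by (rule ctranspose_mult_self_left_factor)
  then have K: "K ** (ctranspose a ** a) = a" by (rule sym)
  obtain L where "ctranspose a = L ** (ctranspose (ctranspose a) ** ctranspose a)"
    by (rule ctranspose_mult_self_left_factor)
  then have L: "L ** (a ** ctranspose a) = ctranspose a"
    unfolding ctranspose_ctranspose by (rule sym)
  have K': "ctranspose a ** (a ** ctranspose K) = ctranspose a"
    using arg_cong[OF K, of ctranspose] by (simp add: ctranspose_mult matrix_mul_assoc)
  have L': "a ** (ctranspose a ** ctranspose L) = a"
    using arg_cong[OF L, of ctranspose] by (simp add: ctranspose_mult matrix_mul_assoc)
  have Aa: "A ** a = a ** A" unfolding a_def by (rule matpow_commute)
  define M where "M = a ** ctranspose a"
  define T where "T = A ** M"
  have ZT: "Z ** T = M"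
    unfolding T_def M_def using Z by (metis matrix_mul_assoc)
  \<comment> \<open>\<open>Z\<close> strips \<open>A\<close> off \<open>T\<close>, \<open>L\<close>
    reduces \<open>a a^*\<close> to \<open>a^*\<close>, and \<open>K\<close> absorbs the
    \<open>a^* a\<close> that appears once \<open>A a\<close> is rewritten as
    \<open>a A\<close>.\<close>
  have "T = K ** L ** Z ** (T ** T)"
  proof -
    have "K ** L ** Z ** (T ** T) = K ** (L ** M) ** T"
      using ZT by (metis matrix_mul_assoc)
    also have "\<dots> = K ** ctranspose a ** T"
      by (simp only: M_def L)
    also have "\<dots> = K ** ctranspose a ** (A ** a) ** ctranspose a"
      by (simp add: M_def T_def matrix_mul_assoc)
    also have "\<dots> = K ** (ctranspose a ** a) ** A ** ctranspose a"
      by (simp add: Aa matrix_mul_assoc)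
    also have "\<dots> = T"
      unfolding K T_def M_def by (simp add: Aa matrix_mul_assoc)
    finally show ?thesis by (rule sym)
  qed
  \<comment> \<open>The mirror image: \<open>L^*\<close> reduces \<open>a a^*\<close> to
    \<open>a\<close>, then \<open>A a Y = a\<close>, and \<open>K^*\<close> absorbs \<open>a\<close>
    after \<open>a^*\<close>.\<close>
  moreover have "T = T ** T ** (ctranspose L ** Y ** ctranspose K)"
  proof -
    have "T ** T ** (ctranspose L ** Y ** ctranspose K)
        = T ** (A ** (a ** (ctranspose a ** ctranspose L)) ** Y) ** ctranspose K"
      by (simp add: T_def M_def matrix_mul_assoc)
    also have "\<dots> = T ** a ** ctranspose K"
      by (simp only: L' Y)
    also have "\<dots> = A ** a ** (ctranspose a ** (a ** ctranspose K))"
      by (simp add: T_def M_def matrix_mul_assoc)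
    also have "\<dots> = T"
      by (simp only: K') (simp add: T_def M_def matrix_mul_assoc)
    finally show ?thesis by (rule sym)
  qed
  ultimately obtain G where "T ** matpow T 1 ** G = matpow T 1"
    and GTG: "G ** T ** G = G" and TG: "T ** G = G ** T"
    using drazin_exists[of T 1 "K ** L ** Z" "ctranspose L ** Y ** ctranspose K"]
    unfolding One_nat_def matpow.simps matrix_mul_rid by blast
  then have "T ** T ** G = T" by simp
  with TG have TGT: "T ** G ** T = T" by (metis matrix_mul_assoc)
  \<comment> \<open>\<open>M = Z T\<close> inherits this from \<open>T T G = T\<close>.\<close>
  have MTG: "M ** T ** G = M"
    using ZT TGT TG by (metis matrix_mul_assoc)
  have lim: "\<forall>\<^sub>F l in at 0. invertible (T + mat l)"
    "((\<lambda>l. M ** matrix_inv (T + mat l)) \<longlongrightarrow> M ** G) (at 0)"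
    using group_inverse_shifted_inverse_limit[OF TGT GTG TG MTG] by auto
  have aTG: "ctranspose a ** T ** G = ctranspose a"
    using MTG L unfolding M_def by (metis matrix_mul_assoc)
  have TGa: "T ** G ** a = a"
  proof -
    have "T ** G ** (A ** a) = T ** G ** T ** ctranspose L"
      unfolding T_def M_def using L' by (metis matrix_mul_assoc)
    also have "\<dots> = A ** a"
      unfolding TGT unfolding T_def M_def using L' by (metis matrix_mul_assoc)
    finally show ?thesis using Y by (metis matrix_mul_assoc)
  qed
  define X where "X = M ** G"
  have core: "is_core_EP_inverse A X"
    unfolding is_core_EP_inverse_iff a_def[symmetric]
  proof (intro conjI mat_range_eqI)
    \<comment> \<open>Since \<open>A M = T\<close>, the product is
      \<open>M G T G = M G\<close>.\<close>
    show "X ** A ** X = X"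
      unfolding X_def using GTG T_def by (metis matrix_mul_assoc)
    show "X = a ** (ctranspose a ** G)"
      by (simp add: X_def M_def matrix_mul_assoc)
    have "X ** T = M" unfolding X_def using MTG TG by (metis matrix_mul_assoc)
    then show "a = X ** (T ** ctranspose L)"
      using L' M_def by (metis matrix_mul_assoc)
    \<comment> \<open>Writing \<open>G = G G T\<close> makes \<open>X\<close> end in
      \<open>a^*\<close>, as needed for the range of \<open>X^*\<close>.\<close>
    have "X = M ** (G ** G ** T)" 
      unfolding X_def using GTG TG by (metis matrix_mul_assoc)
    then have "X = M ** G ** G ** A ** a ** ctranspose a"
      by (simp add: T_def M_def matrix_mul_assoc)
    then show "ctranspose X = a ** ctranspose (M ** G ** G ** A ** a)"
      by (metis ctranspose_ctranspose ctranspose_mult)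
    have "ctranspose a = ctranspose a ** A ** X"
      using aTG by (simp add: X_def T_def matrix_mul_assoc)
    then show "a = ctranspose X ** ctranspose (ctranspose a ** A)"
      by (metis ctranspose_ctranspose ctranspose_mult)
  qed
  then have X: "core_EP_inverse A = X"
    unfolding core_EP_inverse_def using is_core_EP_inverse_unique by blast
  show "is_core_EP_inverse A (core_EP_inverse A)"
    using core X by simp
  show "\<forall>\<^sub>F l in at 0. invertible (A ** a ** ctranspose a + mat l)"
    using lim(1) by (simp add: T_def M_def matrix_mul_assoc)
  show "((\<lambda>l. a ** ctranspose a ** matrix_inv (A ** a ** ctranspose a + mat l))
      \<longlongrightarrow> core_EP_inverse A) (at 0)"
    using lim(2) X by (simp add: X_def T_def M_def matrix_mul_assoc)
qed

section \<open>Duality by conjugate transposition\<close>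

text \<open>Transposing swaps \<open>X\<close> and \<open>X^*\<close> in the range conditions, which
  are symmetric because both ranges coincide.\<close>

lemma is_dual_core_EP_inverse_iff:
  "is_dual_core_EP_inverse A X \<longleftrightarrow> is_core_EP_inverse (ctranspose A) (ctranspose X)"
proof -
  have "X ** A ** X = X \<longleftrightarrow>
      ctranspose X ** ctranspose A ** ctranspose X = ctranspose X"
    using ctranspose_eq_iff[of "X ** A ** X" X] by (simp add: ctranspose_mult matrix_mul_assoc)
  then show ?thesis
    unfolding is_dual_core_EP_inverse_def is_core_EP_inverse_def by auto
qed

lemma dual_core_EP_inverse_eq:
  "dual_core_EP_inverse A = ctranspose (core_EP_inverse (ctranspose A))"
  unfolding dual_core_EP_inverse_def is_dual_core_EP_inverse_iff
proof (rule the_equality)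
  show "is_core_EP_inverse (ctranspose A) (ctranspose (ctranspose (core_EP_inverse (ctranspose A))))"
    using core_EP_inverse_limit(3) by simp
  show "X = ctranspose (core_EP_inverse (ctranspose A))"
    if "is_core_EP_inverse (ctranspose A) (ctranspose X)" for X
    using is_core_EP_inverse_unique[OF that core_EP_inverse_limit(3)]
    by (metis ctranspose_ctranspose)
qed

lemma invertible_ctranspose:
  fixes A :: "complex^'n^'n"
  assumes "invertible A"
  shows "invertible (ctranspose A)" "matrix_inv (ctranspose A) = ctranspose (matrix_inv A)"
proof -
  have I: "ctranspose A ** ctranspose (matrix_inv A) = mat 1"
    using matrix_inv_mult(2)[OF assms] by (simp add: ctranspose_mult[symmetric])
  then show "invertible (ctranspose A)" by (auto simp: invertible_right_inverse)
  show "matrix_inv (ctranspose A) = ctranspose (matrix_inv A)"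
    by (rule matrix_inv_unique[OF I])
qed

lemma tendsto_ctranspose:
  assumes "(F \<longlongrightarrow> L) net"
  shows "((\<lambda>x. ctranspose (F x)) \<longlongrightarrow> ctranspose L) net"
proof (intro vec_tendstoI)
  show "((\<lambda>x. ctranspose (F x) $ i $ j) \<longlongrightarrow> ctranspose L $ i $ j) net" for i j
    unfolding ctranspose_nth by (intro tendsto_intros assms)
qed

theorem theorem4p1:
  fixes A :: "complex^'n^'n" and k :: nat
  assumes "\<not> mat_nilpotent A"
    and "mat_index A = k"
  shows
    "((\<forall>\<^sub>F l in at (0::complex).
         invertible (matpow A (k + 1) ** ctranspose (matpow A k) + mat l)) \<and>
      ((\<lambda>l::complex. matpow A k ** ctranspose (matpow A k) **
           matrix_inv (matpow A (k + 1) ** ctranspose (matpow A k) + mat l))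
         \<longlongrightarrow> core_EP_inverse A) (at 0)) \<and>
     ((\<forall>\<^sub>F l in at (0::complex).
         invertible (ctranspose (matpow A k) ** matpow A (k + 1) + mat l)) \<and>
      ((\<lambda>l::complex.
           matrix_inv (ctranspose (matpow A k) ** matpow A (k + 1) + mat l) **
           ctranspose (matpow A k) ** matpow A k)
         \<longlongrightarrow> dual_core_EP_inverse A) (at 0))"
proof -
  let ?B = "ctranspose A"
  let ?a = "matpow A k" and ?b = "matpow ?B k"
  let ?F = "\<lambda>l. ?B ** ?b ** ctranspose ?b + mat l"
  have b: "?b = ctranspose ?a" by (simp add: ctranspose_matpow)
  have cF: "ctranspose (?F l) = ctranspose ?a ** matpow A (k + 1) + mat (cnj l)" for l
    by (simp add: b ctranspose_add ctranspose_mult matpow_commute matrix_mul_assoc)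
  \<comment> \<open>Conjugate transposition turns the shift \<open>l\<close> into its conjugate;
    conjugation preserves punctured neighbourhoods of 0, so reparametrizing by it leaves the limit
    unchanged.\<close>
  have cnj: "filterlim cnj (at 0) (at 0)"
    unfolding filterlim_at
    by (auto simp: eventually_at_filter intro!: tendsto_eq_intros)
  have k: "mat_index ?B = k" by (simp add: mat_index_ctranspose assms(2))
  have inv: "\<forall>\<^sub>F l in at 0. invertible (?F (cnj l))"
    by (rule eventually_compose_filterlim[OF core_EP_inverse_limit(1)[of ?B, unfolded k] cnj])
  have lim: "((\<lambda>l. ?b ** ctranspose ?b ** matrix_inv (?F (cnj l)))
      \<longlongrightarrow> core_EP_inverse ?B) (at 0)"
    by (rule filterlim_compose[OF core_EP_inverse_limit(2)[of ?B, unfolded k] cnj])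
  \<comment> \<open>Inversion commutes with conjugate transposition where the inverse exists, so the
    two functions are compared only eventually.\<close>
  have eq: "ctranspose (?b ** ctranspose ?b ** matrix_inv (?F (cnj l)))
      = matrix_inv (ctranspose ?a ** matpow A (k + 1) + mat l) ** ctranspose ?a ** ?a"
    if "invertible (?F (cnj l))" for l
    using invertible_ctranspose(2)[OF that] cF[of "cnj l"]
    by (simp add: ctranspose_mult b matrix_mul_assoc)
  have "\<forall>\<^sub>F l in at 0. invertible (ctranspose ?a ** matpow A (k + 1) + mat l)"
    using inv
  proof eventually_elim
    case (elim l)
    then show ?case using invertible_ctranspose(1)[OF elim] cF[of "cnj l"] by simp
  qed
  moreover have "((\<lambda>l. matrix_inv (ctranspose ?a ** matpow A (k + 1) + mat l) ** ctranspose ?a ** ?a)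
      \<longlongrightarrow> dual_core_EP_inverse A) (at 0)"
    unfolding dual_core_EP_inverse_eq
    using tendsto_ctranspose[OF lim]
  proof (rule Lim_transform_eventually)
    show "\<forall>\<^sub>F l in at 0. ctranspose (?b ** ctranspose ?b ** matrix_inv (?F (cnj l)))
      = matrix_inv (ctranspose ?a ** matpow A (k + 1) + mat l) ** ctranspose ?a ** ?a"
      using inv by eventually_elim (rule eq)
  qed
  ultimately show ?thesis
    using core_EP_inverse_limit(1,2)[of A] assms(2) by simp
qed

end
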